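(* Let $H$ be a nonempty finite set of nonnegative integers, and let $A$ be a nonempty finite subset of an additive abelian group $G$. Then the following hold. (1) If there exists $g \in A$ such that $\langle g \rangle \cap \langle A - g \rangle = \{0\}$, then $$|H_{\pm}A| \geq |H_{\pm}(A - g)|.$$ (2) If there exists $g \in A$ such that $\langle g \rangle \cap \langle A \setminus \{g\}\rangle = \{0\}$, then $$|H_{\pm}A| \geq |H_{\pm}((A \cup \{0\}) \setminus \{g\})|.$$ (In both parts, $g$ is the element from the hypothesis.)
   Context: For a finite subset $A=\{a_1,\dots,a_k\}$ (with $|A|=k$) of $G$ and a nonnegative integer $h$, the $h$-fold signed sumset is $h_{\pm}A=\{\sum_{i=1}^k\lambda_i a_i:\lambda_i\in\mathbb{Z}\cap[-h,h],\ \sum_{i=1}^k|\lambda_i|=h\}$, with $0_{\pm}A=\{0\}$. For a finite set $H$ of nonnegative integers, $H_{\pm}A=\bigcup_{h\in H}h_{\pm}A$. For $g\in G$, $A-g=\{a-g:a\in A\}$. For an element or subset $S$ of $G$, $\langle S\rangle$ is the subgroup of $G$ generated by $S$. *)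

theory Defs
  imports "HOL-Computational_Algebra.Group_Closure"
begin

text \<open>
  The ambient abelian group \<open>G\<close> is a type of class \<^class>\<open>ab_group_add\<close>, and
  \<open>\<langle>S\<rangle>\<close> is \<open>group_closure S\<close>.  The library has no integer multiples
  \<open>n a\<close> in such a type.
\<close>

definition int_mult :: "int \<Rightarrow> 'a::ab_group_add \<Rightarrow> 'a" where
  "int_mult n a = (if 0 \<le> n then (\<Sum>_<nat n. a) else - (\<Sum>_<nat (- n). a))"

text \<open>
  Coefficients are indexed by the elements of \<open>A\<close>, so no enumeration
  \<open>a\<^sub>1, \<dots>, a\<^sub>k\<close> has to be chosen; values of \<open>l\<close> outside \<open>A\<close> are irrelevant.
  The definition is intended for finite \<open>A\<close> only.
\<close>

definition signed_sumset :: "nat \<Rightarrow> 'a::ab_group_add set \<Rightarrow> 'a set" where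
  "signed_sumset h A =
     {(\<Sum>a\<in>A. int_mult (l a) a) | l.
        (\<forall>a\<in>A. l a \<in> {- int h..int h}) \<and> (\<Sum>a\<in>A. \<bar>l a\<bar>) = int h}"

definition signed_sumset_set :: "nat set \<Rightarrow> 'a::ab_group_add set \<Rightarrow> 'a set" where
  "signed_sumset_set H A = (\<Union>h\<in>H. signed_sumset h A)"

text \<open>The convention \<open>0\<^sub>\<plusminus>A = {0}\<close> agrees with the general formula, also for \<open>A = {}\<close>.\<close>

lemma signed_sumset_0:
  assumes "finite A"
  shows "signed_sumset 0 A = {0}"
proof -
  have "(\<Sum>a\<in>A. int_mult (l a) a) = 0" if "\<forall>a\<in>A. l a = 0" for l
    using that by (simp add: int_mult_def)
  moreover have "\<exists>l::'a \<Rightarrow> int. \<forall>a\<in>A. l a = 0"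
    by (rule exI[of _ "\<lambda>_. 0"]) simp
  ultimately show ?thesis
    using assms by (fastforce simp: signed_sumset_def)
qed

text \<open>By finiteness, \<open>card\<close> of a signed sumset is never the default value for infinite sets.\<close>

lemma finite_signed_sumset:
  assumes "finite A"
  shows "finite (signed_sumset h A)"
proof (rule finite_subset)
  show "signed_sumset h A \<subseteq>
    (\<lambda>l. \<Sum>a\<in>A. int_mult (l a) a) ` {l. \<forall>a. (a \<in> A \<longrightarrow> l a \<in> {- int h..int h}) \<and> (a \<notin> A \<longrightarrow> l a = 0)}"
  proof
    fix x assume "x \<in> signed_sumset h A"
    then obtain l where x: "x = (\<Sum>a\<in>A. int_mult (l a) a)" and l: "\<forall>a\<in>A. l a \<in> {- int h..int h}"
      by (auto simp: signed_sumset_def)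
    let ?l = "\<lambda>a. if a \<in> A then l a else 0"
    have "x = (\<Sum>a\<in>A. int_mult (?l a) a)"
      unfolding x by (rule sum.cong) auto
    with l show "x \<in> (\<lambda>l. \<Sum>a\<in>A. int_mult (l a) a) `
      {l. \<forall>a. (a \<in> A \<longrightarrow> l a \<in> {- int h..int h}) \<and> (a \<notin> A \<longrightarrow> l a = 0)}"
      by (intro image_eqI[of _ _ ?l]) auto
  qed
  show "finite ((\<lambda>l. \<Sum>a\<in>A. int_mult (l a) a) `
      {l. \<forall>a. (a \<in> A \<longrightarrow> l a \<in> {- int h..int h}) \<and> (a \<notin> A \<longrightarrow> l a = 0)})"
    by (intro finite_imageI finite_set_of_finite_funs assms) simp
qed

lemma finite_signed_sumset_set:
  assumes "finite H" "finite A"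
  shows "finite (signed_sumset_set H A)"
  using assms by (simp add: signed_sumset_set_def finite_signed_sumset)

end

theory Submission
  imports Defs
begin

text \<open>
  In both parts the smaller signed sumset belongs to a set \<open>B\<close> obtained from (a part of) \<open>A\<close> by
  moving each element within its coset of \<open>\<langle>g\<rangle>\<close>: in part (1) every \<open>a\<close> becomes \<open>a - g\<close>, in part (2)
  only \<open>g\<close> itself becomes \<open>0\<close>. Applying the same integer coefficients to \<open>A\<close> instead of \<open>B\<close> therefore
  sends an element of \<open>H\<^sub>\<plusminus>B\<close> to one of \<open>H\<^sub>\<plusminus>A\<close> in the same coset of \<open>\<langle>g\<rangle>\<close>. Now \<open>H\<^sub>\<plusminus>B\<close> lies in a subgroup
  that meets \<open>\<langle>g\<rangle>\<close> trivially, so its elements lie in distinct cosets of \<open>\<langle>g\<rangle>\<close>, and elements of \<open>H\<^sub>\<plusminus>A\<close>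
  in distinct cosets are distinct. In other words, the projection of \<open>\<langle>g\<rangle> \<oplus> \<langle>B\<rangle>\<close> onto the
  second summand maps a part of \<open>H\<^sub>\<plusminus>A\<close> onto \<open>H\<^sub>\<plusminus>B\<close>.
  The lemma \<open>card_signed_sumset_set_le\<close> makes this precise for any two subgroups with
  trivial intersection.
\<close>

lemma int_mult_zero_left [simp]: "int_mult 0 a = 0"
  by (simp add: int_mult_def)

lemma int_mult_diff_right: "int_mult n (a - b) = int_mult n a - int_mult n b"
  by (simp add: int_mult_def sum_subtractf)

lemma sum_in_group_closure:
  assumes "\<And>i. i \<in> I \<Longrightarrow> f i \<in> group_closure S"
  shows "sum f I \<in> group_closure S"
  using assms by (induction I rule: infinite_finite_induct) (auto intro: group_closure_add)

lemma int_mult_in_group_closure: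
  assumes "a \<in> group_closure S"
  shows "int_mult n a \<in> group_closure S"
  using assms by (auto simp: int_mult_def intro!: sum_in_group_closure)

lemma signed_sumset_set_subset_group_closure:
  assumes "B \<subseteq> group_closure T"
  shows "signed_sumset_set H B \<subseteq> group_closure T"
  using assms
  by (auto simp: signed_sumset_set_def signed_sumset_def
      intro!: sum_in_group_closure int_mult_in_group_closure)

text \<open>
  The coefficient of \<open>b\<close> is handed over to \<open>\<phi> b\<close>. Injectivity of \<open>\<phi>\<close> keeps these coefficients
  separate, and the elements of \<open>A\<close> outside the image get the coefficient \<open>0\<close>, so that the total
  absolute weight \<open>h\<close> is unchanged.
\<close>

lemma signed_sumset_transport:
  assumes "finite A" and inj: "inj_on \<phi> B" and sub: "\<phi> ` B \<subseteq> A"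
    and shift: "\<And>b. b \<in> B \<Longrightarrow> \<phi> b - b \<in> group_closure S"
    and y: "y \<in> signed_sumset h B"
  shows "\<exists>x \<in> signed_sumset h A. x - y \<in> group_closure S"
proof -
  from y obtain l where y_eq: "y = (\<Sum>b\<in>B. int_mult (l b) b)"
    and l: "\<forall>b\<in>B. l b \<in> {- int h..int h}" "(\<Sum>b\<in>B. \<bar>l b\<bar>) = int h"
    by (auto simp: signed_sumset_def)
  define m where "m a = (if a \<in> \<phi> ` B then l (inv_into B \<phi> a) else 0)" for a
  have m_image: "m (\<phi> b) = l b" if "b \<in> B" for b
    using that inj by (simp add: m_def)
  have sum_A: "(\<Sum>a\<in>A. f (m a) a) = (\<Sum>b\<in>B. f (l b) (\<phi> b))"
    if "\<And>a. f 0 a = 0" for f :: "int \<Rightarrow> 'a \<Rightarrow> 'c::comm_monoid_add"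
  proof -
    have "(\<Sum>a\<in>A. f (m a) a) = (\<Sum>a\<in>\<phi> ` B. f (m a) a)"
      using assms(1) sub that by (intro sum.mono_neutral_right) (auto simp: m_def)
    also have "\<dots> = (\<Sum>b\<in>B. f (l b) (\<phi> b))"
      using inj by (simp add: sum.reindex m_image)
    finally show ?thesis .
  qed
  define x where "x = (\<Sum>a\<in>A. int_mult (m a) a)"
  have "\<forall>a\<in>A. m a \<in> {- int h..int h}"
    using l(1) inj by (auto simp: m_def)
  moreover have "(\<Sum>a\<in>A. \<bar>m a\<bar>) = int h"
    using sum_A[of "\<lambda>n _. \<bar>n\<bar>"] l(2) by simp
  ultimately have "x \<in> signed_sumset h A"
    by (auto simp: signed_sumset_def x_def)
  moreover have "x - y = (\<Sum>b\<in>B. int_mult (l b) (\<phi> b - b))"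
    using sum_A[of int_mult] by (simp add: x_def y_eq int_mult_diff_right sum_subtractf)
  then have "x - y \<in> group_closure S"
    using shift by (auto intro!: sum_in_group_closure int_mult_in_group_closure)
  ultimately show ?thesis by blast
qed

text \<open>
  Transport only moves elements within their cosets of \<open>\<langle>S\<rangle>\<close>, and two elements of \<open>\<langle>T\<rangle>\<close> in
  one coset of \<open>\<langle>S\<rangle>\<close> differ by an element of \<open>\<langle>S\<rangle> \<inter> \<langle>T\<rangle> = {0}\<close>.
  Hence no two elements are merged.
\<close>

lemma card_signed_sumset_set_le:
  assumes "finite H" and "finite A"
    and inj: "inj_on \<phi> B" and sub: "\<phi> ` B \<subseteq> A"
    and shift: "\<And>b. b \<in> B \<Longrightarrow> \<phi> b - b \<in> group_closure S"
    and B: "B \<subseteq> group_closure T"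
    and trivial: "group_closure S \<inter> group_closure T = {0}"
  shows "card (signed_sumset_set H B) \<le> card (signed_sumset_set H A)"
proof -
  have "\<exists>x \<in> signed_sumset_set H A. x - y \<in> group_closure S"
    if "y \<in> signed_sumset_set H B" for y
    using that signed_sumset_transport[OF assms(2) inj sub shift]
    by (fastforce simp: signed_sumset_set_def)
  then obtain f where f: "\<And>y. y \<in> signed_sumset_set H B \<Longrightarrow>
      f y \<in> signed_sumset_set H A \<and> f y - y \<in> group_closure S"
    by metis
  have "inj_on f (signed_sumset_set H B)"
  proof (rule inj_onI)
    fix y z assume y: "y \<in> signed_sumset_set H B" and z: "z \<in> signed_sumset_set H B"
      and eq: "f y = f z"
    have "(f z - z) - (f y - y) \<in> group_closure S"
      using f y z by (blast intro: group_closure.diff)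
    then have "y - z \<in> group_closure S"
      by (simp add: eq)
    moreover have "y - z \<in> group_closure T"
      using y z signed_sumset_set_subset_group_closure[OF B] by (blast intro: group_closure.diff)
    ultimately have "y - z \<in> {0}"
      unfolding trivial[symmetric] by (rule IntI)
    then show "y = z"
      by simp
  qed
  then show ?thesis
    using f assms(1,2) by (intro card_inj_on_le[of f]) (auto intro: finite_signed_sumset_set)
qed

theorem theorem3p1:
  fixes H :: "nat set" and A :: "'a::ab_group_add set"
  assumes "finite H" and "H \<noteq> {}" and "finite A" and "A \<noteq> {}"
  shows "(\<forall>g\<in>A. group_closure {g} \<inter> group_closure ((\<lambda>a. a - g) ` A) = {0} \<longrightarrow>
            card (signed_sumset_set H A) \<ge> card (signed_sumset_set H ((\<lambda>a. a - g) ` A)))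
       \<and> (\<forall>g\<in>A. group_closure {g} \<inter> group_closure (A - {g}) = {0} \<longrightarrow>
            card (signed_sumset_set H A) \<ge> card (signed_sumset_set H ((A \<union> {0}) - {g})))"
proof (intro conjI ballI impI)
  fix g assume "group_closure {g} \<inter> group_closure ((\<lambda>a. a - g) ` A) = {0}"
  then show "card (signed_sumset_set H ((\<lambda>a. a - g) ` A)) \<le> card (signed_sumset_set H A)"
    using assms(1,3)
    by (intro card_signed_sumset_set_le[where \<phi> = "\<lambda>b. b + g"])
      (auto intro: group_closure.base inj_onI)
next
  fix g assume g: "g \<in> A" and trivial: "group_closure {g} \<inter> group_closure (A - {g}) = {0}"
  \<comment> \<open>It is enough that \<open>\<phi>\<close> is injective into \<open>A\<close>: if \<open>0 \<in> A\<close> and \<open>g \<noteq> 0\<close>, its image just misses \<open>0\<close>,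
    and if \<open>g = 0\<close>, it is the identity.\<close>
  define \<phi> where "\<phi> b = (if b = 0 then g else b)" for b
  show "card (signed_sumset_set H ((A \<union> {0}) - {g})) \<le> card (signed_sumset_set H A)"
  proof (rule card_signed_sumset_set_le[OF assms(1,3) _ _ _ _ trivial])
    show "inj_on \<phi> ((A \<union> {0}) - {g})" "\<phi> ` ((A \<union> {0}) - {g}) \<subseteq> A"
      using g by (auto simp: \<phi>_def inj_on_def)
    show "\<phi> b - b \<in> group_closure {g}" for b
      by (auto simp: \<phi>_def intro: group_closure.base)
    show "(A \<union> {0}) - {g} \<subseteq> group_closure (A - {g})"
      by (auto intro: group_closure.base)
  qed
qed

end
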